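(* Assume that $T$ is finite and that $(\bar c,\bar b)\in\mathbb{R}^p\times\mathbb{R}^T$ and $\bar x\in\mathbb{R}^p$ satisfy $\mathcal{S}(\bar c,\bar b)=\{\bar x\}$. Then $$\mathrm{clm}\,\mathcal{S}\big((\bar c,\bar b),\bar x\big)\ =\ \mathrm{clm}\,\mathcal{S}_{\bar c}(\bar b,\bar x)\ =\ \sup_{D\in\mathcal{K}_{\bar b}(\bar x)}\ \limsup_{\substack{x\to\bar x\\ f_D(x)>0}}\ \frac{1}{d_*\big(0_p,\partial f_D(x)\big)}.$$
   Context: Setting: $T$ is a finite index set, $a_t\in\mathbb{R}^p$ ($t\in T$) are fixed vectors, and $b=(b_t)_{t\in T}\in\mathbb{R}^T$ with $\|b\|_\infty=\max_{t\in T}|b_t|$. $\mathbb{R}^p$ carries an arbitrary norm $\|\cdot\|$ with dual norm $\|u\|_*=\max_{\|x\|\le1}\langle u,x\rangle$; $d_*$ is the distance associated with $\|\cdot\|_*$ (including point-to-set distance), and $0_p$ is the zero vector of $\mathbb{R}^p$. For $(c,b)\in\mathbb{R}^p\times\mathbb{R}^T$, $P(c,b)$ is the problem: minimize $\langle c,x\rangle$ subject to $\langle a_t,x\rangle\le b_t$ for all $t\in T$. The parameter space has norm $\|(c,b)\|=\max\{\|c\|_*,\|b\|_\infty\}$. $\mathcal{S}(c,b)\subset\mathbb{R}^p$ is the set of optimal solutions of $P(c,b)$, and for fixed $c$, $\mathcal{S}_c(b):=\mathcal{S}(c,b)$ as a set-valued mapping of $b\in\mathbb{R}^T$. Calmness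 modulus: for a set-valued mapping $S$ from a metric space $(Y,d_Y)$ to a metric space $(X,d_X)$ and $\bar x\in S(\bar y)$, $\mathrm{clm}\,S(\bar y,\bar x)\in[0,\infty]$ is the infimum of all $\kappa\ge0$ for which there are neighborhoods $U$ of $\bar x$ and $V$ of $\bar y$ with $d_X(x,S(\bar y))\le\kappa\, d_Y(y,\bar y)$ whenever $y\in V$ and $x\in S(y)\cap U$ (it is $+\infty$ if no such $\kappa$ exists). Active indices: $T_b(x)=\{t\in T:\langle a_t,x\rangle=b_t\}$ for feasible $x$. $\mathrm{cone}(X)$ is the conical convex hull of $X$, always containing $0$ (so $\mathrm{cone}(\emptyset)=\{0_p\}$). Define $$\mathcal{K}_{\bar b}(\bar x)=\{D\subset T_{\bar b}(\bar x): |D|\le p,\ -\bar c\in\mathrm{cone}\{a_t: t\in D\}\}.$$ For $D\in\mathcal{K}_{\bar b}(\bar x)$, the convex function $f_D:\mathbb{R}^p\to\mathbb{R}$ is $$f_D(x)=\sup\big\{\langle a_t,x\rangle-\bar b_t,\ t\in T;\ -\langle a_t,x\rangle+\bar b_t,\ t\in D\big\},$$ and $\partial f_D(x)$ is its convex subdifferential. *)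

theory Defs
  imports "HOL-Analysis.Analysis"
begin

definition is_norm :: "('a::real_vector \<Rightarrow> real) \<Rightarrow> bool" where
  "is_norm n \<longleftrightarrow>
     (\<forall>x. 0 \<le> n x) \<and> (\<forall>x. n x = 0 \<longleftrightarrow> x = 0) \<and>
     (\<forall>r x. n (r *\<^sub>R x) = \<bar>r\<bar> * n x) \<and> (\<forall>x y. n (x + y) \<le> n x + n y)"

text \<open>
  The constructor \<open>metric\<close> is meaningful only on pairs that form a metric space;
  lemma \<open>is_norm_imp_Metric_space\<close> shows that this is so for every norm, and the
  lemmas \<open>is_norm_dual_norm\<close>, \<open>is_norm_infnorm\<close> and \<open>is_norm_param_norm\<close> cover the
  norms used below.
\<close>
definition norm_metric :: "('a::real_vector \<Rightarrow> real) \<Rightarrow> 'a metric" where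
  "norm_metric n = metric (UNIV, \<lambda>x y. n (x - y))"

text \<open>The supremum is attained, since the unit ball of a norm on a Euclidean space is compact.\<close>
definition dual_norm :: "('a::euclidean_space \<Rightarrow> real) \<Rightarrow> 'a \<Rightarrow> real" where
  "dual_norm n u = Sup {u \<bullet> x | x. n x \<le> 1}"

text \<open>On \<open>real ^ 't\<close> the library's \<open>infnorm\<close> is the maximum of the absolute values of the
  coordinates.\<close>
definition param_norm :: "('a::euclidean_space \<Rightarrow> real) \<Rightarrow> 'a \<times> 'b::euclidean_space \<Rightarrow> real" where
  "param_norm n = (\<lambda>(c, b). max (dual_norm n c) (infnorm b))"

text \<open>Extended-real valued, so that the distance to the empty set is \<open>\<infinity>\<close>.\<close>
definition mdist_set :: "'a metric \<Rightarrow> 'a \<Rightarrow> 'a set \<Rightarrow> ereal" where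
  "mdist_set m x A = (INF z\<in>A. ereal (mdist m x z))"

definition calmness_modulus ::
    "'y metric \<Rightarrow> 'x metric \<Rightarrow> ('y \<Rightarrow> 'x set) \<Rightarrow> 'y \<Rightarrow> 'x \<Rightarrow> ereal" where
  "calmness_modulus mY mX S y0 x0 =
     Inf {ereal \<kappa> | \<kappa>. 0 \<le> \<kappa> \<and>
       (\<exists>U V. openin (mtopology_of mX) U \<and> x0 \<in> U \<and> openin (mtopology_of mY) V \<and> y0 \<in> V \<and>
          (\<forall>y\<in>V. \<forall>x\<in>S y \<inter> U. mdist_set mX x (S y0) \<le> ereal (\<kappa> * mdist mY y y0)))}"

definition feasible_set :: "('t \<Rightarrow> real ^ 'p) \<Rightarrow> real ^ 't \<Rightarrow> (real ^ 'p) set" where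
  "feasible_set a b = {x. \<forall>t. a t \<bullet> x \<le> b $ t}"

definition optimal_set ::
    "('t \<Rightarrow> real ^ 'p) \<Rightarrow> real ^ 'p \<Rightarrow> real ^ 't \<Rightarrow> (real ^ 'p) set" where
  "optimal_set a c b = {x. is_arg_min (\<lambda>x. c \<bullet> x) (\<lambda>x. x \<in> feasible_set a b) x}"

definition active_indices :: "('t \<Rightarrow> real ^ 'p) \<Rightarrow> real ^ 't \<Rightarrow> real ^ 'p \<Rightarrow> 't set" where
  "active_indices a b x = {t. a t \<bullet> x = b $ t}"

definition KKT_index_sets ::
    "('t \<Rightarrow> real ^ 'p) \<Rightarrow> real ^ 'p \<Rightarrow> real ^ 't \<Rightarrow> real ^ 'p \<Rightarrow> 't set set" where
  "KKT_index_sets a c b x =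
     {D. D \<subseteq> active_indices a b x \<and> card D \<le> CARD('p) \<and> - c \<in> convex_cone hull (a ` D)}"

definition f_sup :: "('t \<Rightarrow> real ^ 'p) \<Rightarrow> real ^ 't \<Rightarrow> 't set \<Rightarrow> real ^ 'p \<Rightarrow> real" where
  "f_sup a b D x =
     Sup ({a t \<bullet> x - b $ t | t. t \<in> UNIV} \<union> {- (a t \<bullet> x) + b $ t | t. t \<in> D})"

definition subdifferential :: "('a::real_inner \<Rightarrow> real) \<Rightarrow> 'a \<Rightarrow> 'a set" where
  "subdifferential f x = {u. \<forall>y. f x + u \<bullet> (y - x) \<le> f y}"

lemma is_norm_imp_Metric_space:
  assumes "is_norm n"
  shows "Metric_space UNIV (\<lambda>x y. n (x - y))"
proof
  fix x y z :: 'a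
  show "0 \<le> n (x - y)" using assms by (simp add: is_norm_def)
  have "n (- 1 *\<^sub>R (y - x)) = \<bar>- 1\<bar> * n (y - x)"
    using assms unfolding is_norm_def by blast
  then show "n (x - y) = n (y - x)" by simp
  show "n (x - y) = 0 \<longleftrightarrow> x = y" using assms by (simp add: is_norm_def)
  have "n ((x - y) + (y - z)) \<le> n (x - y) + n (y - z)"
    using assms unfolding is_norm_def by blast
  then show "n (x - z) \<le> n (x - y) + n (y - z)" by simp
qed

lemma mspace_norm_metric: "is_norm n \<Longrightarrow> mspace (norm_metric n) = UNIV"
  unfolding norm_metric_def
  by (rule Metric_space.mspace_metric[OF is_norm_imp_Metric_space])

lemma mdist_norm_metric: "is_norm n \<Longrightarrow> mdist (norm_metric n) x y = n (x - y)"
  unfolding norm_metric_def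
  by (simp add: Metric_space.mdist_metric[OF is_norm_imp_Metric_space])

lemma is_norm_zero: "is_norm n \<Longrightarrow> n 0 = 0"
  unfolding is_norm_def by blast

lemma is_norm_lower_bound:
  fixes n :: "'a::euclidean_space \<Rightarrow> real"
  assumes n: "is_norm n"
  obtains m where "0 < m" "\<And>x. m * norm x \<le> n x"
proof -
  have conv: "convex_on UNIV n"
  proof (rule convex_onI)
    fix t :: real and x y :: 'a assume t: "0 < t" "t < 1"
    have "n ((1 - t) *\<^sub>R x + t *\<^sub>R y) \<le> n ((1 - t) *\<^sub>R x) + n (t *\<^sub>R y)"
      using n unfolding is_norm_def by blast
    also have "\<dots> = \<bar>1 - t\<bar> * n x + \<bar>t\<bar> * n y"
      using n unfolding is_norm_def by metis
    finally show "n ((1 - t) *\<^sub>R x + t *\<^sub>R y) \<le> (1 - t) * n x + t * n y"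
      using t by simp
  qed simp
  have cont: "continuous_on (sphere 0 1) n"
    using convex_on_continuous[OF open_UNIV conv] continuous_on_subset by blast
  have ne: "sphere (0::'a) 1 \<noteq> {}" by simp
  obtain s where s: "s \<in> sphere 0 1" "\<And>y. y \<in> sphere 0 1 \<Longrightarrow> n s \<le> n y"
    using continuous_attains_inf[OF compact_sphere ne cont] by blast
  have "s \<noteq> 0" using s(1) by auto
  then have pos: "0 < n s" using n unfolding is_norm_def by (metis order_le_less)
  have "n s * norm x \<le> n x" for x
  proof (cases "x = 0")
    case True then show ?thesis using n by (simp add: is_norm_def)
  next
    case False
    have "n s \<le> n ((1 / norm x) *\<^sub>R x)" using False by (intro s(2)) simp
    also have "\<dots> = \<bar>1 / norm x\<bar> * n x" using n unfolding is_norm_def by blast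
    finally show ?thesis using False by (simp add: field_simps)
  qed
  with pos show ?thesis using that by blast
qed

lemma bdd_above_dual_norm:
  fixes n :: "'a::euclidean_space \<Rightarrow> real"
  assumes "is_norm n"
  shows "bdd_above {u \<bullet> x | x. n x \<le> 1}"
proof -
  obtain m where m: "0 < m" "\<And>x. m * norm x \<le> n x" using is_norm_lower_bound[OF assms] by blast
  have "u \<bullet> x \<le> norm u * (1 / m)" if "n x \<le> 1" for x
  proof -
    have "norm x \<le> 1 / m" using m(1) order_trans[OF m(2) that] by (simp add: field_simps)
    then show ?thesis using norm_cauchy_schwarz[of u x] by (meson mult_left_mono norm_ge_zero order_trans)
  qed
  then show ?thesis by (intro bdd_aboveI[of _ "norm u * (1 / m)"]) auto
qed

lemma inner_le_dual_norm:
  assumes "is_norm n" "n x \<le> 1"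
  shows "u \<bullet> x \<le> dual_norm n u"
  unfolding dual_norm_def using assms by (intro cSup_upper bdd_above_dual_norm) auto

lemma dual_norm_le:
  assumes "is_norm n" "\<And>x. n x \<le> 1 \<Longrightarrow> u \<bullet> x \<le> K"
  shows "dual_norm n u \<le> K"
  unfolding dual_norm_def
proof (rule cSup_least)
  have "n 0 \<le> 1" by (simp add: is_norm_zero[OF assms(1)])
  then show "{u \<bullet> x | x. n x \<le> 1} \<noteq> {}" by blast
qed (use assms(2) in auto)

lemma is_norm_dual_norm:
  fixes n :: "'a::euclidean_space \<Rightarrow> real"
  assumes n: "is_norm n"
  shows "is_norm (dual_norm n)"
proof -
  have n0: "n 0 \<le> 1" by (simp add: is_norm_zero[OF n])
  have nm: "n (r *\<^sub>R x) = \<bar>r\<bar> * n x" for r x using n unfolding is_norm_def by blast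
  have nonneg: "0 \<le> dual_norm n u" for u
    using inner_le_dual_norm[OF n n0, of u] by simp
  have zero: "dual_norm n u = 0 \<longleftrightarrow> u = 0" for u
  proof
    assume d: "dual_norm n u = 0"
    show "u = 0"
    proof (rule ccontr)
      assume u: "u \<noteq> 0"
      then have nu: "0 < n u" using n unfolding is_norm_def by (metis order_le_less)
      have "u \<bullet> ((1 / n u) *\<^sub>R u) \<le> 0"
        using inner_le_dual_norm[OF n, of "(1 / n u) *\<^sub>R u" u] d nu nm by simp
      moreover have "0 < u \<bullet> ((1 / n u) *\<^sub>R u)" using u nu by simp
      ultimately show False by simp
    qed
  next
    assume "u = 0"
    then show "dual_norm n u = 0"
      using nonneg[of u] dual_norm_le[OF n, of u 0] by simp
  qed
  have le: "dual_norm n (r *\<^sub>R u) \<le> \<bar>r\<bar> * dual_norm n u" for r u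
  proof (rule dual_norm_le[OF n])
    fix x assume x: "n x \<le> 1"
    have "n (sgn r *\<^sub>R x) \<le> 1" using x nm by (auto simp: sgn_if)
    from inner_le_dual_norm[OF n this, of u]
    have "\<bar>r\<bar> * (sgn r * (u \<bullet> x)) \<le> \<bar>r\<bar> * dual_norm n u"
      by (intro mult_left_mono) auto
    then show "(r *\<^sub>R u) \<bullet> x \<le> \<bar>r\<bar> * dual_norm n u"
      by (metis abs_mult_sgn inner_scaleR_left mult.assoc)
  qed
  have scale: "dual_norm n (r *\<^sub>R u) = \<bar>r\<bar> * dual_norm n u" for r u
  proof (cases "r = 0")
    case True then show ?thesis using zero by simp
  next
    case False
    have "dual_norm n u \<le> \<bar>1 / r\<bar> * dual_norm n (r *\<^sub>R u)"
      using le[of "1 / r" "r *\<^sub>R u"] False by simp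
    then have "\<bar>r\<bar> * dual_norm n u \<le> dual_norm n (r *\<^sub>R u)"
      using False by (simp add: field_simps)
    then show ?thesis using le[of r u] by simp
  qed
  have "dual_norm n (u + v) \<le> dual_norm n u + dual_norm n v" for u v
    using inner_le_dual_norm[OF n]
    by (intro dual_norm_le[OF n]) (simp add: inner_add_left add_mono)
  with nonneg zero scale show ?thesis unfolding is_norm_def by blast
qed

lemma is_norm_infnorm: "is_norm (infnorm :: 'a::euclidean_space \<Rightarrow> real)"
  by (simp add: is_norm_def infnorm_pos_le infnorm_eq_0 infnorm_mul infnorm_triangle)

lemma is_norm_param_norm:
  assumes "is_norm n"
  shows "is_norm (param_norm n :: 'a::euclidean_space \<times> 'b::euclidean_space \<Rightarrow> real)"
proof -
  have d: "\<And>x. 0 \<le> dual_norm n x" "\<And>x. dual_norm n x = 0 \<longleftrightarrow> x = 0"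
    "\<And>r x. dual_norm n (r *\<^sub>R x) = \<bar>r\<bar> * dual_norm n x"
    "\<And>x y. dual_norm n (x + y) \<le> dual_norm n x + dual_norm n y"
    using is_norm_dual_norm[OF assms] unfolding is_norm_def by blast+
  have i: "0 \<le> infnorm b" "infnorm b = 0 \<longleftrightarrow> b = 0"
    "infnorm (b + b') \<le> infnorm b + infnorm b'" for b b' :: 'b
    by (simp_all add: infnorm_pos_le infnorm_eq_0 infnorm_triangle)
  have zero: "max (dual_norm n c) (infnorm b) = 0 \<longleftrightarrow> c = 0 \<and> b = 0" for c and b :: 'b
    using d(1)[of c] i(1)[of b] d(2)[of c] i(2)[of b] by (auto simp: max_def)
  have scale: "max (\<bar>r\<bar> * dual_norm n c) (\<bar>r\<bar> * infnorm b)
      = \<bar>r\<bar> * max (dual_norm n c) (infnorm b)" for r c and b :: 'b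
    by (simp add: max_mult_distrib_left)
  have tri: "max (dual_norm n (c + c')) (infnorm (b + b'))
      \<le> max (dual_norm n c) (infnorm b) + max (dual_norm n c') (infnorm b')" for c c' and b b' :: 'b
    using d(4)[of c c'] i(3)[of b b'] by (auto simp: max_def)
  show ?thesis unfolding is_norm_def param_norm_def
    using d i zero scale tri by (auto simp: le_max_iff_disj zero_prod_def infnorm_mul)
qed

end

theory Submission
  imports Defs
begin

text \<open>
  For \<open>D\<close> in \<open>KKT_index_sets a cbar bbar xbar\<close>, uniqueness of the optimal solution says that
  \<open>f_sup a bbar D\<close> is positive off \<open>xbar\<close> and zero at \<open>xbar\<close>. For such a convex function the
  upper limit of the reciprocal distances \<open>1 / d(0, \<partial>f)\<close> is the local error bound modulus, the
  infimum of the \<open>\<kappa>\<close> with \<open>nrm (x - xbar) \<le> \<kappa> f(x)\<close> near \<open>xbar\<close>. If \<open>x\<close> is optimal for \<open>(c, b)\<close>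
  with KKT set \<open>D\<close>, then \<open>f_sup a bbar D x \<le> infnorm (b - bbar)\<close>, and near the reference point
  \<open>D\<close> is also a KKT set for \<open>(cbar, bbar)\<close>, since there are finitely many index sets and finitely
  generated cones are closed; hence the error bounds give calmness of the full map. Conversely
  every \<open>x\<close> is optimal for \<open>cbar\<close> and some \<open>b\<close> with \<open>infnorm (b - bbar) \<le> f_sup a bbar D x\<close>, so
  calmness in \<open>b\<close> alone already gives the error bounds.
\<close>

section \<open>Arbitrary norms on a Euclidean space\<close>

lemma is_normD:
  assumes "is_norm n"
  shows "0 \<le> n x" "n x = 0 \<longleftrightarrow> x = 0" "n (r *\<^sub>R x) = \<bar>r\<bar> * n x" "n (x + y) \<le> n x + n y"
  using assms unfolding is_norm_def by blast+

lemma is_norm_minus: "is_norm n \<Longrightarrow> n (- x) = n x"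
  using is_normD(3)[of n "-1" x] by simp

lemma is_norm_diff_commute: "is_norm n \<Longrightarrow> n (x - y) = n (y - x)"
  using is_norm_minus[of n "x - y"] by simp

lemma is_norm_diff_triangle: "is_norm n \<Longrightarrow> n (x - z) \<le> n (x - y) + n (y - z)"
  using is_normD(4)[of n "x - y" "y - z"] by simp

lemma is_norm_convex_on:
  assumes "is_norm n"
  shows "convex_on UNIV n"
proof (rule convex_onI)
  fix t :: real and x y :: 'a
  assume "0 < t" "t < 1"
  then show "n ((1 - t) *\<^sub>R x + t *\<^sub>R y) \<le> (1 - t) * n x + t * n y"
    using is_normD(4)[OF assms, of "(1 - t) *\<^sub>R x" "t *\<^sub>R y"] by (simp add: is_normD(3)[OF assms])
qed simp

lemma is_norm_continuous_on:
  fixes n :: "'a::euclidean_space \<Rightarrow> real"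
  assumes "is_norm n"
  shows "continuous_on A n"
  using convex_on_continuous[OF open_UNIV is_norm_convex_on[OF assms]] continuous_on_subset by blast

lemma eventually_is_norm_less:
  fixes n :: "'a::euclidean_space \<Rightarrow> real"
  assumes "is_norm n" "0 < e"
  shows "\<forall>\<^sub>F x in nhds x0. n (x - x0) < e"
proof -
  have "open {x. n (x - x0) < e}"
    by (intro open_Collect_less continuous_on_compose2[OF is_norm_continuous_on[OF assms(1), of UNIV]]
        continuous_intros) auto
  then show ?thesis
    using assms by (auto simp: eventually_nhds is_norm_zero intro!: exI[of _ "{x. n (x - x0) < e}"])
qed

text \<open>Equivalence of norms: the lower bound \<open>m * norm x \<le> n x\<close> puts an
  \<open>n\<close>-ball inside each Euclidean ball, and continuity of \<open>n\<close> gives the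
  converse.\<close>

lemma eventually_nhds_is_norm:
  fixes n :: "'a::euclidean_space \<Rightarrow> real"
  assumes "is_norm n"
  shows "eventually P (nhds x0) \<longleftrightarrow> (\<exists>e>0. \<forall>x. n (x - x0) < e \<longrightarrow> P x)"
proof
  assume "eventually P (nhds x0)"
  then obtain d where d: "0 < d" "\<And>x. dist x x0 < d \<Longrightarrow> P x"
    unfolding eventually_nhds_metric by blast
  obtain m where m: "0 < m" "\<And>x. m * norm x \<le> n x" using is_norm_lower_bound[OF assms] by blast
  have "P x" if "n (x - x0) < m * d" for x
  proof (rule d(2))
    have "m * norm (x - x0) < m * d" using m(2)[of "x - x0"] that by simp
    then show "dist x x0 < d" using m(1) by (simp add: dist_norm)
  qed
  then show "\<exists>e>0. \<forall>x. n (x - x0) < e \<longrightarrow> P x" using d m by (intro exI[of _ "m * d"]) auto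
next
  assume "\<exists>e>0. \<forall>x. n (x - x0) < e \<longrightarrow> P x"
  then show "eventually P (nhds x0)"
    using eventually_is_norm_less[OF assms] by (metis (mono_tags, lifting) eventually_mono)
qed

lemma openin_norm_metric:
  fixes n :: "'a::euclidean_space \<Rightarrow> real"
  assumes "is_norm n"
  shows "openin (mtopology_of (norm_metric n)) U \<longleftrightarrow> open U"
proof -
  interpret M: Metric_space UNIV "\<lambda>x y. n (x - y)" by (rule is_norm_imp_Metric_space[OF assms])
  have "openin (mtopology_of (norm_metric n)) U \<longleftrightarrow> (\<forall>x\<in>U. \<exists>r>0. \<forall>y. n (y - x) < r \<longrightarrow> y \<in> U)"
    unfolding norm_metric_def M.mtopology_of M.openin_mtopology
    by (simp add: subset_iff is_norm_diff_commute[OF assms] M.mball_def Ball_def)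
  also have "\<dots> \<longleftrightarrow> (\<forall>x\<in>U. eventually (\<lambda>y. y \<in> U) (nhds x))"
    unfolding eventually_nhds_is_norm[OF assms] ..
  also have "\<dots> \<longleftrightarrow> open U"
    unfolding eventually_nhds by (subst open_subopen) (simp add: subset_eq)
  finally show ?thesis .
qed

text \<open>With \<open>S y0 = {x0}\<close> the point-to-set distance is just
  \<open>n (x - x0)\<close>. Norm topologies agree with the usual one, so \<open>U\<close> and
  \<open>V\<close> merge into a single product neighborhood.\<close>

lemma calmness_modulus_singleton:
  fixes m :: "'a::euclidean_space \<Rightarrow> real" and n :: "'b::euclidean_space \<Rightarrow> real"
  assumes "is_norm m" "is_norm n" "S y0 = {x0}"
  shows "calmness_modulus (norm_metric m) (norm_metric n) S y0 x0 =
    Inf {ereal \<kappa> |\<kappa>. 0 \<le> \<kappa> \<and>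
      (\<forall>\<^sub>F z in nhds (y0, x0). snd z \<in> S (fst z) \<longrightarrow> n (snd z - x0) \<le> \<kappa> * m (fst z - y0))}"
proof -
  have "(\<exists>U V. open U \<and> x0 \<in> U \<and> open V \<and> y0 \<in> V \<and>
      (\<forall>y\<in>V. \<forall>x\<in>S y \<inter> U. n (x - x0) \<le> \<kappa> * m (y - y0))) \<longleftrightarrow>
    (\<forall>\<^sub>F z in nhds (y0, x0). snd z \<in> S (fst z) \<longrightarrow> n (snd z - x0) \<le> \<kappa> * m (fst z - y0))"
    (is "?L \<longleftrightarrow> ?R") for \<kappa>
  proof
    assume ?L
    then obtain U V where UV: "open U" "x0 \<in> U" "open V" "y0 \<in> V"
      "\<And>y x. y \<in> V \<Longrightarrow> x \<in> S y \<Longrightarrow> x \<in> U \<Longrightarrow> n (x - x0) \<le> \<kappa> * m (y - y0)" by blast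
    then show ?R unfolding eventually_nhds
      by (intro exI[of _ "V \<times> U"]) (auto simp: open_Times)
  next
    assume ?R
    then obtain W where W: "open W" "(y0, x0) \<in> W"
      "\<And>z. z \<in> W \<Longrightarrow> snd z \<in> S (fst z) \<Longrightarrow> n (snd z - x0) \<le> \<kappa> * m (fst z - y0)"
      unfolding eventually_nhds by blast
    obtain V U where "open V" "open U" "(y0, x0) \<in> V \<times> U" "V \<times> U \<subseteq> W"
      using open_prod_elim[OF W(1,2)] by blast
    then show ?L using W(3) by (intro exI[of _ U] exI[of _ V]) force
  qed
  then show ?thesis
    unfolding calmness_modulus_def mdist_set_def assms(3)
    by (simp add: openin_norm_metric mdist_norm_metric assms(1,2))
qed

section \<open>Error bounds for convex functions\<close>

text \<open>Separating the strict epigraph of \<open>f\<close> from the hypograph of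
  \<open>y \<mapsto> f z - \<mu> n(y - z)\<close> is what the subdifferential sum rule amounts to here.\<close>
lemma subdifferential_dual_norm_le:
  fixes f n :: "'a::euclidean_space \<Rightarrow> real"
  assumes n: "is_norm n" and f: "convex_on UNIV f" and "0 \<le> \<mu>"
    and min: "\<And>y. f z \<le> f y + \<mu> * n (y - z)"
  shows "\<exists>u\<in>subdifferential f z. dual_norm n u \<le> \<mu>"
proof -
  define A where "A = {p. f (fst p) < snd p}"
  define B where "B = {p. snd p \<le> f z - \<mu> * n (fst p - z)}"
  have "convex A" unfolding A_def
  proof (rule convexI)
    fix p q :: "'a \<times> real" and u v :: real
    assume *: "p \<in> {p. f (fst p) < snd p}" "q \<in> {p. f (fst p) < snd p}" "0 \<le> u" "0 \<le> v" "u + v = 1"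
    have "f (u *\<^sub>R fst p + v *\<^sub>R fst q) \<le> u * f (fst p) + v * f (fst q)"
      using f * unfolding convex_on_def by auto
    also have "\<dots> < u * snd p + v * snd q"
    proof (cases "u = 0")
      case True
      then show ?thesis using * by simp
    next
      case False
      then show ?thesis using * by (intro add_less_le_mono) (auto intro: mult_left_mono)
    qed
    finally show "u *\<^sub>R p + v *\<^sub>R q \<in> {p. f (fst p) < snd p}" by simp
  qed
  moreover have "convex B" unfolding B_def
  proof (rule convexI)
    fix p q :: "'a \<times> real" and u v :: real
    assume *: "p \<in> {p. snd p \<le> f z - \<mu> * n (fst p - z)}" "q \<in> {p. snd p \<le> f z - \<mu> * n (fst p - z)}"
      "0 \<le> u" "0 \<le> v" "u + v = 1"
    have "u *\<^sub>R fst p + v *\<^sub>R fst q - z = u *\<^sub>R (fst p - z) + v *\<^sub>R (fst q - z)"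
      using *(5) by (simp add: algebra_simps flip: scaleR_add_left)
    then have "n (u *\<^sub>R fst p + v *\<^sub>R fst q - z) \<le> u * n (fst p - z) + v * n (fst q - z)"
      using is_normD(4)[OF n, of "u *\<^sub>R (fst p - z)" "v *\<^sub>R (fst q - z)"] *
      by (simp add: is_normD(3)[OF n])
    then have "\<mu> * n (u *\<^sub>R fst p + v *\<^sub>R fst q - z) \<le> \<mu> * (u * n (fst p - z) + v * n (fst q - z))"
      using \<open>0 \<le> \<mu>\<close> by (rule mult_left_mono)
    moreover have "u * snd p \<le> u * (f z - \<mu> * n (fst p - z))" "v * snd q \<le> v * (f z - \<mu> * n (fst q - z))"
      using * by (auto intro: mult_left_mono)
    moreover have "u * f z + v * f z = f z" using *(5) by (simp flip: distrib_right)
    ultimately show "u *\<^sub>R p + v *\<^sub>R q \<in> {p. snd p \<le> f z - \<mu> * n (fst p - z)}"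
      by (simp add: algebra_simps)
  qed
  moreover have "(z, f z + 1) \<in> A" "(z, f z) \<in> B" by (simp_all add: A_def B_def is_norm_zero[OF n])
  moreover have "A \<inter> B = {}"
  proof -
    have "False" if "f (fst p) < snd p" "snd p \<le> f z - \<mu> * n (fst p - z)" for p
      using min[of "fst p"] that by simp
    then show ?thesis by (auto simp: A_def B_def)
  qed
  ultimately obtain q \<beta> where q: "q \<noteq> 0" "\<And>p. p \<in> B \<Longrightarrow> q \<bullet> p \<le> \<beta>" "\<And>p. p \<in> A \<Longrightarrow> q \<bullet> p \<ge> \<beta>"
    using separating_hyperplane_sets[of B A] by blast
  obtain w r where wr: "q = (w, r)" by (cases q)
  have B: "w \<bullet> y + r * (f z - \<mu> * n (y - z)) \<le> \<beta>" for y
    using q(2)[of "(y, f z - \<mu> * n (y - z))"] by (simp add: B_def wr)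
  have A: "\<beta> \<le> w \<bullet> y + r * s" if "f y < s" for y s
    using q(3)[of "(y, s)"] that by (simp add: A_def wr)
  have Bz: "w \<bullet> z + r * f z \<le> \<beta>" using B[of z] by (simp add: is_norm_zero[OF n])
  have "0 \<le> r" using A[of z "f z + 1"] Bz by (simp add: algebra_simps)
  \<comment> \<open>No vertical hyperplane separates: \<open>A\<close> and \<open>B\<close> have
    points over every \<open>y\<close>, so \<open>w \<bullet> y\<close> would be constant and
    \<open>w\<close> zero.\<close>
  moreover have "r \<noteq> 0"
  proof
    assume "r = 0"
    then have "w \<bullet> y = \<beta>" for y using A[of y "f y + 1"] B[of y] by simp
    then have "w \<bullet> w = w \<bullet> 0" by metis
    then show False using q(1) wr \<open>r = 0\<close> by (simp add: zero_prod_def)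
  qed
  ultimately have r: "0 < r" by simp
  \<comment> \<open>\<open>A\<close> is the strict epigraph; here \<open>s\<close> tends to
    \<open>f y\<close> from above.\<close>
  have A': "\<beta> \<le> w \<bullet> y + r * f y" for y
  proof (rule field_le_epsilon)
    fix e :: real assume "0 < e"
    then show "\<beta> \<le> w \<bullet> y + r * f y + e"
      using A[of y "f y + e / r"] r by (simp add: algebra_simps)
  qed
  \<comment> \<open>The slope of the separating hyperplane, read as the graph of an affine
    function.\<close>
  define u where "u = (- 1 / r) *\<^sub>R w"
  have w: "w = - r *\<^sub>R u" using r by (simp add: u_def)
  have "u \<in> subdifferential f z"
    unfolding subdifferential_def
  proof (intro CollectI allI)
    fix y
    have "r * (f z + u \<bullet> (y - z)) \<le> r * f y"
      using A'[of y] Bz unfolding w by (simp add: algebra_simps inner_diff_right)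
    then show "f z + u \<bullet> (y - z) \<le> f y" using r by simp
  qed
  moreover have "dual_norm n u \<le> \<mu>"
  proof (rule dual_norm_le[OF n])
    fix x assume x: "n x \<le> 1"
    \<comment> \<open>\<open>w\<close> is a negative multiple of \<open>u\<close>, hence the
      evaluation at \<open>z - x\<close>.\<close>
    have "r * (u \<bullet> x) \<le> r * (\<mu> * n x)"
      using B[of "z - x"] A'[of z] unfolding w
      by (simp add: algebra_simps inner_diff_right is_norm_minus[OF n])
    then have "u \<bullet> x \<le> \<mu> * n x" using r by simp
    also have "\<dots> \<le> \<mu> * 1" using x \<open>0 \<le> \<mu>\<close> by (rule mult_left_mono)
    finally show "u \<bullet> x \<le> \<mu>" by simp
  qed
  ultimately show ?thesis by blast
qed

lemma inner_le_dual_norm_mult: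
  assumes "is_norm n"
  shows "u \<bullet> x \<le> dual_norm n u * n x"
proof (cases "x = 0")
  case False
  then have nx: "0 < n x" using is_normD(1,2)[OF assms, of x] by simp
  then have "u \<bullet> ((1 / n x) *\<^sub>R x) \<le> dual_norm n u"
    by (intro inner_le_dual_norm[OF assms]) (simp add: is_normD(3)[OF assms])
  then show ?thesis using nx by (simp add: field_simps)
qed (simp add: is_norm_zero[OF assms])

text \<open>In \<open>ereal\<close>, \<open>1 / 0 = \<infinity>\<close>, so a zero distance to the
  subdifferential is covered.\<close>

lemma ereal_le_one_divide:
  assumes "0 \<le> d" "d \<le> ereal (1 / \<kappa>)" "0 < \<kappa>"
  shows "ereal \<kappa> \<le> 1 / d"
proof (cases d)
  case (real r)
  then show ?thesis
  proof (cases "r = 0")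
    case False
    then have "0 < r" "r \<le> 1 / \<kappa>" using assms real by auto
    then show ?thesis using real \<open>0 < \<kappa>\<close> by (simp add: one_ereal_def field_simps)
  qed (use real in \<open>simp add: divide_ereal_def\<close>)
qed (use assms in auto)

text \<open>The case \<open>d = \<infinity>\<close>, the distance to an empty subdifferential, gives
  \<open>1 / d = 0\<close>.\<close>

lemma ereal_one_divide_le:
  assumes "ereal (1 / \<kappa>) \<le> d" "0 < \<kappa>"
  shows "1 / d \<le> ereal \<kappa>"
proof (cases d)
  case (real r)
  then have r: "1 / \<kappa> \<le> r" using assms by simp
  moreover have "0 < 1 / \<kappa>" using assms by simp
  ultimately have "0 < r" by linarith
  then show ?thesis using real r \<open>0 < \<kappa>\<close> by (simp add: one_ereal_def field_simps)
qed (use assms in auto)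

text \<open>Outside the compact \<open>n\<close>-ball \<open>C\<close> the penalty alone exceeds
  \<open>f x\<close>, the value of the objective at \<open>x\<close>, so a minimizer over
  \<open>C\<close> is global.\<close>

lemma exists_penalty_minimizer:
  fixes f n :: "'a::euclidean_space \<Rightarrow> real"
  assumes n: "is_norm n" and f: "continuous_on UNIV f" "\<And>y. 0 \<le> f y" and "0 < \<mu>"
  obtains z where "\<And>y. f z + \<mu> * n (z - x) \<le> f y + \<mu> * n (y - x)"
proof -
  define g where "g y = f y + \<mu> * n (y - x)" for y
  define C where "C = {y. n (y - x) \<le> f x / \<mu>}"
  have cn: "continuous_on UNIV (\<lambda>y. n (y - x))"
    by (intro continuous_on_compose2[OF is_norm_continuous_on[OF n, of UNIV]] continuous_intros) auto
  have "closed C" unfolding C_def by (intro closed_Collect_le cn continuous_intros)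
  moreover have "bounded C"
  proof -
    obtain m where m: "0 < m" "\<And>x. m * norm x \<le> n x" using is_norm_lower_bound[OF n] by blast
    have "dist x y \<le> f x / \<mu> / m" if "y \<in> C" for y
      using m(1) m(2)[of "y - x"] that \<open>0 < \<mu>\<close>
      by (simp add: C_def dist_norm norm_minus_commute field_simps)
        (smt (verit) mult.commute mult.left_commute mult_le_cancel_left_pos)
    then show ?thesis unfolding bounded_def by blast
  qed
  ultimately have "compact C" by (simp add: compact_eq_bounded_closed)
  have xC: "x \<in> C" using f(2)[of x] \<open>0 < \<mu>\<close> by (simp add: C_def is_norm_zero[OF n])
  have "continuous_on C g"
    unfolding g_def by (intro continuous_intros continuous_on_subset[OF f(1)] continuous_on_subset[OF cn]) auto
  then obtain z where z: "z \<in> C" "\<And>y. y \<in> C \<Longrightarrow> g z \<le> g y"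
    using continuous_attains_inf[OF \<open>compact C\<close>] xC by blast
  have "g z \<le> g y" for y
  proof (cases "y \<in> C")
    case False
    then have "f x < \<mu> * n (y - x)" using \<open>0 < \<mu>\<close> by (simp add: C_def field_simps)
    then show ?thesis using z(2)[OF xC] f(2)[of y] by (simp add: g_def is_norm_zero[OF n])
  qed (rule z(2))
  then show ?thesis using that unfolding g_def by blast
qed

text \<open>The penalty minimizer \<open>z\<close> below plays the role of the point supplied by Ekeland's variational
  principle: were the error bound to fail at \<open>x\<close>, then \<open>z \<noteq> x0\<close> would carry a subgradient
  of dual norm at most \<open>1 / \<kappa>\<close>.\<close>
lemma error_bound_of_Limsup:
  fixes f n :: "'a::euclidean_space \<Rightarrow> real"
  assumes n: "is_norm n" and f: "convex_on UNIV f" "f x0 = 0" "\<And>x. x \<noteq> x0 \<Longrightarrow> 0 < f x"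
    and lim: "Limsup (at x0 within {x. 0 < f x})
      (\<lambda>x. 1 / mdist_set (norm_metric (dual_norm n)) 0 (subdifferential f x)) < ereal \<kappa>"
    and "0 < \<kappa>"
  shows "\<forall>\<^sub>F x in nhds x0. n (x - x0) \<le> \<kappa> * f x"
proof -
  have f0: "0 \<le> f y" for y using f(2) f(3)[of y] by (cases "y = x0") auto
  have "\<forall>\<^sub>F x in at x0 within {x. 0 < f x}.
      1 / mdist_set (norm_metric (dual_norm n)) 0 (subdifferential f x) < ereal \<kappa>"
    using Limsup_lessD[OF lim] .
  then have "\<forall>\<^sub>F x in nhds x0. x \<noteq> x0 \<longrightarrow>
      1 / mdist_set (norm_metric (dual_norm n)) 0 (subdifferential f x) < ereal \<kappa>"
    unfolding eventually_at_filter using f(3) by (auto elim: eventually_mono)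
  then obtain e where e: "0 < e" "\<And>x. n (x - x0) < e \<Longrightarrow> x \<noteq> x0 \<Longrightarrow>
      1 / mdist_set (norm_metric (dual_norm n)) 0 (subdifferential f x) < ereal \<kappa>"
    unfolding eventually_nhds_is_norm[OF n] by blast
  \<comment> \<open>Half of \<open>e\<close> suffices because \<open>z\<close> will be closer to
    \<open>x\<close> than \<open>x0\<close> is, so that
    \<open>n (z - x0) < 2 * n (x - x0) < e\<close>.\<close>
  have "n (x - x0) \<le> \<kappa> * f x" if x: "n (x - x0) < e / 2" for x
  proof (rule ccontr)
    assume "\<not> n (x - x0) \<le> \<kappa> * f x"
    then have less: "f x < 1 / \<kappa> * n (x - x0)" using \<open>0 < \<kappa>\<close> by (simp add: field_simps)
    obtain z where z: "\<And>y. f z + 1 / \<kappa> * n (z - x) \<le> f y + 1 / \<kappa> * n (y - x)"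
      using exists_penalty_minimizer[OF n convex_on_continuous[OF open_UNIV f(1)] f0, where \<mu> = "1 / \<kappa>" and x = x]
        \<open>0 < \<kappa>\<close> by auto
    have "1 / \<kappa> * n (z - x) \<le> f x" using z[of x] f0[of z] by (simp add: is_norm_zero[OF n])
    then have "1 / \<kappa> * n (z - x) < 1 / \<kappa> * n (x - x0)" using less by simp
    then have zx: "n (z - x) < n (x - x0)" using \<open>0 < \<kappa>\<close> by (simp add: divide_less_cancel)
    then have "z \<noteq> x0" using is_norm_diff_commute[OF n, of x x0] by auto
    have "n (z - x0) < e" using is_norm_diff_triangle[OF n, of z x0 x] zx x by simp
    \<comment> \<open>The triangle inequality recenters the penalty from \<open>x\<close> to
      \<open>z\<close>.\<close>
    have "f z \<le> f y + 1 / \<kappa> * n (y - z)" for y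
    proof -
      have "1 / \<kappa> * n (y - x) \<le> 1 / \<kappa> * (n (y - z) + n (z - x))"
        using \<open>0 < \<kappa>\<close> is_norm_diff_triangle[OF n, of y x z] by (intro mult_left_mono) auto
      then show ?thesis using z[of y] by (simp add: distrib_left)
    qed
    then obtain u where u: "u \<in> subdifferential f z" "dual_norm n u \<le> 1 / \<kappa>"
      using subdifferential_dual_norm_le[OF n f(1), where \<mu> = "1 / \<kappa>" and z = z] \<open>0 < \<kappa>\<close> by auto
    define d where "d = mdist_set (norm_metric (dual_norm n)) 0 (subdifferential f z)"
    have "d \<le> ereal (dual_norm n u)"
      unfolding d_def mdist_set_def using u(1)
      by (intro INF_lower2[of u])
        (auto simp: mdist_norm_metric[OF is_norm_dual_norm[OF n]] is_norm_minus[OF is_norm_dual_norm[OF n]])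
    then have d1: "d \<le> ereal (1 / \<kappa>)" using u(2) by (meson ereal_less_eq(3) order_trans)
    have d0: "0 \<le> d"
      unfolding d_def mdist_set_def by (intro INF_greatest) simp
    have "1 / d < ereal \<kappa>" using e(2)[OF \<open>n (z - x0) < e\<close> \<open>z \<noteq> x0\<close>] by (simp add: d_def)
    then show False using ereal_le_one_divide[OF d0 d1 \<open>0 < \<kappa>\<close>] by simp
  qed
  then show ?thesis unfolding eventually_nhds_is_norm[OF n] using \<open>0 < e\<close> by (intro exI[of _ "e/2"]) simp
qed

text \<open>The subgradient inequality tested at \<open>x0\<close> gives
  \<open>f x \<le> dual_norm n u * n (x - x0)\<close>. With the error bound, every subgradient at
  \<open>x\<close> has dual norm at least \<open>1 / \<kappa>\<close>.\<close>

lemma Limsup_of_error_bound: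
  fixes f n :: "'a::euclidean_space \<Rightarrow> real"
  assumes n: "is_norm n" and f: "f x0 = 0"
    and ev: "\<forall>\<^sub>F x in nhds x0. n (x - x0) \<le> \<kappa> * f x"
  shows "Limsup (at x0 within {x. 0 < f x})
      (\<lambda>x. 1 / mdist_set (norm_metric (dual_norm n)) 0 (subdifferential f x)) \<le> ereal \<kappa>"
proof (rule Limsup_bounded)
  have "1 / mdist_set (norm_metric (dual_norm n)) 0 (subdifferential f x) \<le> ereal \<kappa>"
    if x: "n (x - x0) \<le> \<kappa> * f x" "x \<noteq> x0" "0 < f x" for x
  proof -
    have "0 < n (x - x0)" using x(2) is_normD(1,2)[OF n, of "x - x0"] by simp
    then have \<kappa>: "0 < \<kappa>" using x(1,3) by (smt (verit) mult_nonpos_nonneg)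
    define d where "d = mdist_set (norm_metric (dual_norm n)) 0 (subdifferential f x)"
    have "ereal (1 / \<kappa>) \<le> d"
      unfolding d_def mdist_set_def
    proof (rule INF_greatest)
      fix u assume "u \<in> subdifferential f x"
      then have "f x + u \<bullet> (x0 - x) \<le> f x0" unfolding subdifferential_def by blast
      then have "f x \<le> u \<bullet> (x - x0)" using f by (simp add: inner_diff_right)
      also have "\<dots> \<le> dual_norm n u * n (x - x0)" by (rule inner_le_dual_norm_mult[OF n])
      also have "\<dots> \<le> dual_norm n u * (\<kappa> * f x)"
        using x(1) is_normD(1)[OF is_norm_dual_norm[OF n]] by (rule mult_left_mono)
      finally have "1 \<le> dual_norm n u * \<kappa>" using x(3) by (simp add: mult.assoc[symmetric])
      then show "ereal (1 / \<kappa>) \<le> ereal (mdist (norm_metric (dual_norm n)) 0 u)"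
        using \<kappa> by (simp add: mdist_norm_metric[OF is_norm_dual_norm[OF n]]
            is_norm_minus[OF is_norm_dual_norm[OF n]] field_simps)
    qed
    then have "1 / d \<le> ereal \<kappa>" using \<kappa> by (rule ereal_one_divide_le)
    then show ?thesis by (simp add: d_def)
  qed
  then show "\<forall>\<^sub>F x in at x0 within {x. 0 < f x}.
      1 / mdist_set (norm_metric (dual_norm n)) 0 (subdifferential f x) \<le> ereal \<kappa>"
    unfolding eventually_at_filter using ev by (auto elim!: eventually_mono)
qed

section \<open>Finitely generated cones and optimality conditions\<close>

lemma convex_cone_hull_finite:
  assumes "finite V"
  shows "convex_cone hull V = {\<Sum>v\<in>V. u v *\<^sub>R v |u. \<forall>v\<in>V. 0 \<le> u v}" (is "_ = ?C")
proof
  show "convex_cone hull V \<subseteq> ?C"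
  proof (rule hull_minimal)
    show "V \<subseteq> ?C"
    proof
      fix x assume "x \<in> V"
      then have "x = (\<Sum>v\<in>V. (if v = x then 1 else 0) *\<^sub>R v)"
        using assms by (simp add: if_distrib[of "\<lambda>r. r *\<^sub>R _"] cong: if_cong)
      then show "x \<in> ?C" by (intro CollectI exI[of _ "\<lambda>v. if v = x then 1 else 0"]) auto
    qed
    show "convex_cone ?C"
      unfolding convex_cone_iff
    proof (intro conjI ballI allI impI)
      show "0 \<in> ?C" by (intro CollectI exI[of _ "\<lambda>_. 0"]) simp
    next
      fix x y assume "x \<in> ?C" "y \<in> ?C"
      then obtain u w where uw: "x = (\<Sum>v\<in>V. u v *\<^sub>R v)" "\<forall>v\<in>V. 0 \<le> u v"
        "y = (\<Sum>v\<in>V. w v *\<^sub>R v)" "\<forall>v\<in>V. 0 \<le> w v" by blast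
      then show "x + y \<in> ?C"
        by (intro CollectI exI[of _ "\<lambda>v. u v + w v"]) (simp add: scaleR_add_left sum.distrib)
    next
      fix x and c :: real assume "x \<in> ?C" "0 \<le> c"
      then obtain u where "x = (\<Sum>v\<in>V. u v *\<^sub>R v)" "\<forall>v\<in>V. 0 \<le> u v" by blast
      then show "c *\<^sub>R x \<in> ?C"
        using \<open>0 \<le> c\<close> by (intro CollectI exI[of _ "\<lambda>v. c * u v"]) (simp add: scaleR_sum_right)
    qed
  qed
  have "(\<Sum>v\<in>W. u v *\<^sub>R v) \<in> convex_cone hull V" if "finite W" "W \<subseteq> V" "\<forall>v\<in>W. 0 \<le> u v" for u W
    using that
  proof (induction W)
    case (insert v W)
    then have "u v *\<^sub>R v \<in> convex_cone hull V" by (intro convex_cone_hull_mul hull_inc) auto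
    then show ?case using insert by (simp add: convex_cone_hull_add)
  qed (simp add: convex_cone_hull_contains_0)
  then show "?C \<subseteq> convex_cone hull V" using assms by blast
qed

text \<open>A dependent \<open>V\<close> loses a generator: a multiple of a linear relation is
  subtracted from the coefficients until one of them vanishes.\<close>

lemma conic_caratheodory:
  fixes V :: "'a::real_vector set"
  assumes "finite V" "y \<in> convex_cone hull V"
  shows "\<exists>B\<subseteq>V. independent B \<and> y \<in> convex_cone hull B"
  using assms
proof (induction V rule: finite_psubset_induct)
  case (psubset V)
  show ?case
  proof (cases "independent V")
    case False
    then obtain w v1 where w: "v1 \<in> V" "w v1 \<noteq> 0" "(\<Sum>v\<in>V. w v *\<^sub>R v) = 0"
      using dependent_finite[OF psubset.hyps(1)] by auto
    \<comment> \<open>The relation is negated if necessary, so that the minimal ratio below ranges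
      over a nonempty set.\<close>
    obtain w where w: "\<exists>v\<in>V. 0 < w v" "(\<Sum>v\<in>V. w v *\<^sub>R v) = 0"
    proof (cases "0 < w v1")
      case False
      then show ?thesis using w that[of "\<lambda>v. - w v"] by (force simp: sum_negf)
    qed (use w that in blast)
    obtain u where u: "y = (\<Sum>v\<in>V. u v *\<^sub>R v)" "\<And>v. v \<in> V \<Longrightarrow> 0 \<le> u v"
      using psubset.prems convex_cone_hull_finite[OF psubset.hyps(1)] by auto
    define P where "P = {v\<in>V. 0 < w v}"
    have "finite P" "P \<noteq> {}" using psubset.hyps(1) w(1) by (auto simp: P_def)
    then obtain v0 where v0: "v0 \<in> P" "\<And>v. v \<in> P \<Longrightarrow> u v0 / w v0 \<le> u v / w v"
      using ex_min_if_finite[of "(\<lambda>v. u v / w v) ` P"] by (fastforce simp: not_less)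
    \<comment> \<open>The largest step that keeps all coefficients \<open>u v - s * w v\<close>
      nonnegative; it annihilates the one at \<open>v0\<close>.\<close>
    define s where "s = u v0 / w v0"
    have v0': "v0 \<in> V" "0 < w v0" using v0(1) by (auto simp: P_def)
    then have "0 \<le> s" using u(2) by (simp add: s_def)
    define u' where "u' v = u v - s * w v" for v
    have "0 \<le> u' v" if "v \<in> V" for v
    proof (cases "0 < w v")
      case True
      then show ?thesis using v0(2)[of v] that by (simp add: P_def u'_def s_def field_simps)
    next
      case False
      then have "s * w v \<le> 0" using \<open>0 \<le> s\<close> by (simp add: mult_nonneg_nonpos)
      then show ?thesis using u(2)[OF that] by (simp add: u'_def)
    qed
    moreover have "y = (\<Sum>v\<in>V - {v0}. u' v *\<^sub>R v)"
    proof -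
      have "(\<Sum>v\<in>V. u' v *\<^sub>R v) = y - s *\<^sub>R (\<Sum>v\<in>V. w v *\<^sub>R v)"
        by (simp add: u'_def u(1) scaleR_diff_left sum_subtractf scaleR_sum_right)
      moreover have "u' v0 = 0" using v0' by (simp add: u'_def s_def)
      ultimately show ?thesis using w(2) sum.remove[OF psubset.hyps(1) v0'(1), of "\<lambda>v. u' v *\<^sub>R v"] by simp
    qed
    ultimately have "y \<in> convex_cone hull (V - {v0})"
      using psubset.hyps(1) by (auto simp: convex_cone_hull_finite)
    then show ?thesis using psubset.IH[of "V - {v0}"] v0'(1) by blast
  qed (use psubset.prems in blast)
qed

lemma optimal_set_iff:
  "x \<in> optimal_set a c b \<longleftrightarrow> x \<in> feasible_set a b \<and> (\<forall>y\<in>feasible_set a b. c \<bullet> x \<le> c \<bullet> y)"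
  by (auto simp: optimal_set_def is_arg_min_linorder)

text \<open>For feasible \<open>y\<close>, the half-space of vectors making a nonpositive product
  with \<open>y - x\<close> contains the active \<open>a t\<close>, hence their cone and
  \<open>- c\<close>.\<close>

lemma optimal_set_of_multipliers:
  assumes x: "x \<in> feasible_set a b" and D: "D \<subseteq> active_indices a b x"
    and c: "- c \<in> convex_cone hull (a ` D)"
  shows "x \<in> optimal_set a c b"
  unfolding optimal_set_iff
proof (intro conjI ballI x)
  fix y assume y: "y \<in> feasible_set a b"
  have "a t \<bullet> y \<le> a t \<bullet> x" if "t \<in> D" for t
  proof -
    have "a t \<bullet> x = b $ t" using D that by (auto simp: active_indices_def)
    then show ?thesis using y by (simp add: feasible_set_def)
  qed
  then have "a ` D \<subseteq> {v. (y - x) \<bullet> v \<le> 0}"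
    by (auto simp: inner_diff_left) (metis inner_commute)
  then have "convex_cone hull (a ` D) \<subseteq> {v. (y - x) \<bullet> v \<le> 0}"
    by (rule hull_minimal) (rule convex_cone_halfspace_le)
  then have "(y - x) \<bullet> (- c) \<le> 0" using c by blast
  then show "c \<bullet> x \<le> c \<bullet> y" by (simp add: inner_commute[of _ c] inner_diff_right)
qed

text \<open>Farkas argument: the cone is closed, so if it misses \<open>- c\<close> a hyperplane
  with normal \<open>w\<close> separates them, and \<open>- w\<close> is a feasible descent
  direction at \<open>x\<close>.\<close>

lemma multipliers_of_optimal:
  fixes a :: "'t::finite \<Rightarrow> real ^ 'p"
  assumes "x \<in> optimal_set a c b"
  shows "- c \<in> convex_cone hull (a ` active_indices a b x)"
proof (rule ccontr)
  let ?A = "active_indices a b x"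
  let ?K = "convex_cone hull (a ` ?A)"
  assume "- c \<notin> ?K"
  then obtain w \<beta> where w: "w \<bullet> (- c) < \<beta>" "\<And>v. v \<in> ?K \<Longrightarrow> \<beta> < w \<bullet> v"
    using separating_hyperplane_closed_point[OF convex_convex_cone_hull, of "a ` ?A" "- c"]
      closed_convex_cone_hull[of "a ` ?A"] by auto
  have "\<beta> < 0" using w(2)[OF convex_cone_hull_contains_0] by simp
  have act: "0 \<le> w \<bullet> a t" if "t \<in> ?A" for t
  proof (rule ccontr)
    assume neg: "\<not> 0 \<le> w \<bullet> a t"
    \<comment> \<open>This multiple lies exactly on the hyperplane, where strict separation allows
      no point of the cone.\<close>
    have "(\<beta> / (w \<bullet> a t)) *\<^sub>R a t \<in> ?K"
      using that neg \<open>\<beta> < 0\<close> by (intro convex_cone_hull_mul hull_inc) (auto simp: divide_nonpos_neg)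
    from w(2)[OF this] show False using neg by simp
  qed
  have feas: "a t \<bullet> x \<le> b $ t" for t using assms by (auto simp: optimal_set_iff feasible_set_def)
  \<comment> \<open>Active constraints hold for every \<open>s > 0\<close> by the sign of
    \<open>w \<bullet> a t\<close>; inactive ones have slack and hold for small \<open>s\<close> by
    continuity.\<close>
  have "\<forall>\<^sub>F s in at_right (0::real). a t \<bullet> (x - s *\<^sub>R w) \<le> b $ t" for t
  proof (cases "t \<in> ?A")
    case True
    have "a t \<bullet> (x - s *\<^sub>R w) \<le> b $ t" if "0 < s" for s
    proof -
      have "0 \<le> s * (a t \<bullet> w)" using that act[OF True] by (simp add: inner_commute)
      then show ?thesis using feas[of t] unfolding inner_diff_right inner_scaleR_right by linarith
    qed
    then show ?thesis using eventually_at_right_less[of "0::real"] by (rule eventually_mono[rotated])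
  next
    case False
    then have "a t \<bullet> x < b $ t" using feas[of t] by (simp add: active_indices_def)
    moreover have "((\<lambda>s. a t \<bullet> (x - s *\<^sub>R w)) \<longlongrightarrow> a t \<bullet> (x - 0 *\<^sub>R w)) (at_right 0)"
      by (intro tendsto_intros)
    ultimately have "\<forall>\<^sub>F s in at_right (0::real). a t \<bullet> (x - s *\<^sub>R w) < b $ t"
      by (intro order_tendstoD(2)) auto
    then show ?thesis by eventually_elim simp
  qed
  then have "\<forall>\<^sub>F s in at_right (0::real). \<forall>t. a t \<bullet> (x - s *\<^sub>R w) \<le> b $ t"
    by (simp add: eventually_all_finite)
  then have "\<forall>\<^sub>F s in at_right (0::real). 0 < s \<and> x - s *\<^sub>R w \<in> feasible_set a b"
    unfolding feasible_set_def by (auto intro: eventually_conj eventually_at_right_less)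
  then obtain s where s: "0 < s" "x - s *\<^sub>R w \<in> feasible_set a b"
    using eventually_happens'[OF trivial_limit_at_right_real] by blast
  then have "c \<bullet> x \<le> c \<bullet> (x - s *\<^sub>R w)" using assms by (simp add: optimal_set_iff)
  then have "s * (w \<bullet> c) \<le> 0" by (simp add: inner_diff_right inner_commute)
  then show False using s(1) w(1) \<open>\<beta> < 0\<close> by (simp add: mult_le_0_iff)
qed

lemma KKT_index_set_of_optimal:
  fixes a :: "'t::finite \<Rightarrow> real ^ 'p"
  assumes "x \<in> optimal_set a c b"
  obtains D where "D \<in> KKT_index_sets a c b x"
proof -
  obtain B where B: "B \<subseteq> a ` active_indices a b x" "independent B" "- c \<in> convex_cone hull B"
    using conic_caratheodory[OF _ multipliers_of_optimal[OF assms]] by auto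
  \<comment> \<open>Several indices may carry the same vector; choosing one for each gives
    \<open>D\<close> the cardinality of the independent set \<open>B\<close>.\<close>
  obtain D where D: "D \<subseteq> active_indices a b x" "inj_on a D" "B = a ` D"
    using B(1) by (auto simp: subset_image_inj)
  have "card D = card B" using D by (simp add: card_image)
  also have "\<dots> \<le> CARD('p)" using independent_card_le[OF B(2)] by simp
  finally show ?thesis using that[of D] B D by (simp add: KKT_index_sets_def)
qed

section \<open>The functions attached to the index sets\<close>

lemma f_sup_le_iff:
  fixes a :: "'t::finite \<Rightarrow> real ^ 'p"
  shows "f_sup a b D x \<le> r \<longleftrightarrow> (\<forall>t. a t \<bullet> x - b $ t \<le> r) \<and> (\<forall>t\<in>D. b $ t - a t \<bullet> x \<le> r)"
proof -
  let ?X = "{a t \<bullet> x - b $ t |t. t \<in> UNIV} \<union> {- (a t \<bullet> x) + b $ t |t. t \<in> D}"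
  have "?X = range (\<lambda>t. a t \<bullet> x - b $ t) \<union> (\<lambda>t. - (a t \<bullet> x) + b $ t) ` D" by auto
  then have "finite ?X" by simp
  moreover have "?X \<noteq> {}" by auto
  ultimately have "Sup ?X \<le> r \<longleftrightarrow> (\<forall>v\<in>?X. v \<le> r)"
    by (simp add: cSup_le_iff bdd_above_finite)
  also have "\<dots> \<longleftrightarrow> (\<forall>t. a t \<bullet> x - b $ t \<le> r) \<and> (\<forall>t\<in>D. b $ t - a t \<bullet> x \<le> r)" by (auto; fastforce)
  finally show ?thesis unfolding f_sup_def .
qed

lemma convex_on_f_sup:
  fixes a :: "'t::finite \<Rightarrow> real ^ 'p"
  shows "convex_on UNIV (f_sup a b D)"
proof (rule convex_onI)
  fix s :: real and x y :: "real ^ 'p"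
  assume s: "0 < s" "s < 1"
  have x: "a t \<bullet> x - b $ t \<le> f_sup a b D x" "t \<in> D \<Longrightarrow> b $ t - a t \<bullet> x \<le> f_sup a b D x" for t x
    using f_sup_le_iff[of a b D x "f_sup a b D x"] by auto
  have comb: "a t \<bullet> ((1 - s) *\<^sub>R x + s *\<^sub>R y) - b $ t = (1 - s) * (a t \<bullet> x - b $ t) + s * (a t \<bullet> y - b $ t)" for t
    by (simp add: inner_add_right algebra_simps)
  have comb': "b $ t - a t \<bullet> ((1 - s) *\<^sub>R x + s *\<^sub>R y) = (1 - s) * (b $ t - a t \<bullet> x) + s * (b $ t - a t \<bullet> y)" for t
    by (simp add: inner_add_right algebra_simps)
  show "f_sup a b D ((1 - s) *\<^sub>R x + s *\<^sub>R y) \<le> (1 - s) * f_sup a b D x + s * f_sup a b D y"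
    unfolding f_sup_le_iff comb comb' using s x by (auto intro!: add_mono mult_left_mono)
qed simp

context
  fixes a :: "'t::finite \<Rightarrow> real ^ 'p" and c xbar :: "real ^ 'p" and b :: "real ^ 't" and D :: "'t set"
  assumes unique: "optimal_set a c b = {xbar}" and D: "D \<in> KKT_index_sets a c b xbar"
begin

text \<open>A nonpositive value makes \<open>x\<close> feasible with \<open>D\<close> active, so the
  multipliers on \<open>D\<close> certify that \<open>x\<close> is optimal, and uniqueness
  applies.\<close>

lemma f_sup_nonpos_imp_eq:
  assumes "f_sup a b D x \<le> 0"
  shows "x = xbar"
proof -
  have "x \<in> feasible_set a b" "D \<subseteq> active_indices a b x"
    using assms by (force simp: f_sup_le_iff feasible_set_def active_indices_def intro: antisym)+
  then show ?thesis
    using optimal_set_of_multipliers[of x a b D c] D unique by (auto simp: KKT_index_sets_def)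
qed

lemma f_sup_pos: "x \<noteq> xbar \<Longrightarrow> 0 < f_sup a b D x"
  using f_sup_nonpos_imp_eq[of x] by linarith

lemma f_sup_xbar: "f_sup a b D xbar = 0"
proof (rule antisym)
  have "xbar \<in> feasible_set a b" using unique by (auto simp: optimal_set_iff)
  then show "f_sup a b D xbar \<le> 0"
    using D by (auto simp: f_sup_le_iff KKT_index_sets_def feasible_set_def active_indices_def)
  \<comment> \<open>For empty \<open>D\<close> no term is known in advance to vanish at
    \<open>xbar\<close>; the bound is obtained as a limit of positive values nearby.\<close>
  show "0 \<le> f_sup a b D xbar"
  proof (rule tendsto_lowerbound)
    have "isCont (f_sup a b D) xbar"
      using convex_on_continuous[OF open_UNIV convex_on_f_sup[of a b D]] by (simp add: continuous_on_eq_continuous_at)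
    then show "(f_sup a b D \<longlongrightarrow> f_sup a b D xbar) (at xbar)" by (simp add: isCont_def)
    show "\<forall>\<^sub>F x in at xbar. 0 \<le> f_sup a b D x"
      using f_sup_pos by (auto simp: eventually_at_filter less_imp_le)
  qed simp
qed

end

text \<open>Feasibility for \<open>b'\<close> bounds \<open>a t \<bullet> x - b $ t\<close> by
  \<open>b' $ t - b $ t\<close>; on \<open>D\<close> equality bounds the opposite sign as
  well.\<close>

lemma f_sup_le_infnorm:
  fixes a :: "'t::finite \<Rightarrow> real ^ 'p"
  assumes "x \<in> feasible_set a b'" "D \<subseteq> active_indices a b' x"
  shows "f_sup a b D x \<le> infnorm (b' - b)"
proof -
  have "\<bar>b' $ t - b $ t\<bar> \<le> infnorm (b' - b)" for t
    using component_le_infnorm_cart[of "b' - b" t] by simp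
  moreover have "a t \<bullet> x \<le> b' $ t" "t \<in> D \<Longrightarrow> a t \<bullet> x = b' $ t" for t
    using assms by (auto simp: feasible_set_def active_indices_def)
  ultimately show ?thesis unfolding f_sup_le_iff by (smt (verit))
qed

text \<open>The right-hand side is moved as little as possible so that \<open>x\<close> becomes feasible with \<open>D\<close>
  active.\<close>
lemma exists_perturbation_optimal:
  fixes a :: "'t::finite \<Rightarrow> real ^ 'p"
  assumes "- c \<in> convex_cone hull (a ` D)" "0 \<le> f_sup a b D x"
  obtains b' where "x \<in> optimal_set a c b'" "infnorm (b' - b) \<le> f_sup a b D x"
proof
  define b' where "b' = (\<chi> t. if t \<in> D then a t \<bullet> x else max (b $ t) (a t \<bullet> x))"
  show "x \<in> optimal_set a c b'"
    using assms(1) by (intro optimal_set_of_multipliers[of _ _ _ D])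
      (auto simp: feasible_set_def active_indices_def b'_def)
  have "a t \<bullet> x - b $ t \<le> f_sup a b D x" "t \<in> D \<Longrightarrow> b $ t - a t \<bullet> x \<le> f_sup a b D x" for t
    using f_sup_le_iff[of a b D x "f_sup a b D x"] by auto
  \<comment> \<open>A constraint outside \<open>D\<close> that \<open>x\<close> already satisfies is
    not moved; there the bound is \<open>0 \<le> f_sup a b D x\<close>.\<close>
  then have "\<bar>(b' - b) $ t\<bar> \<le> f_sup a b D x" for t
    using assms(2) by (cases "t \<in> D") (auto simp: b'_def abs_le_iff max_def)
  then show "infnorm (b' - b) \<le> f_sup a b D x"
    unfolding infnorm_cart by (intro cSup_least) auto
qed

section \<open>The calmness moduli\<close>

text \<open>For fixed \<open>D\<close> the triples having \<open>D\<close> as KKT set form a closed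
  set, so a \<open>D\<close> excluded at the reference point stays excluded nearby. There are
  finitely many \<open>D\<close>.\<close>

lemma eventually_KKT_index_sets:
  fixes a :: "'t::finite \<Rightarrow> real ^ 'p"
  shows "\<forall>\<^sub>F z in nhds ((c0, b0), x0).
    KKT_index_sets a (fst (fst z)) (snd (fst z)) (snd z) \<subseteq> KKT_index_sets a c0 b0 x0"
proof -
  let ?K = "\<lambda>z. KKT_index_sets a (fst (fst z)) (snd (fst z)) (snd z)"
  have "\<forall>\<^sub>F z in nhds ((c0, b0), x0). D \<in> ?K z \<longrightarrow> D \<in> KKT_index_sets a c0 b0 x0" for D
  proof (cases "D \<in> KKT_index_sets a c0 b0 x0")
    case False
    have "{z. D \<in> ?K z} = (if card D \<le> CARD('p) then
        (\<lambda>z. - fst (fst z)) -` (convex_cone hull (a ` D)) \<inter> (\<Inter>t\<in>D. {z. a t \<bullet> snd z = snd (fst z) $ t})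
        else {})"
      by (auto simp: KKT_index_sets_def active_indices_def)
    moreover have "closed \<dots>"
      by (auto intro!: closed_Int closed_vimage closed_INT closed_Collect_eq closed_convex_cone_hull
          continuous_intros)
    ultimately have "open (- {z. D \<in> ?K z})" by (simp add: open_Compl)
    moreover have "((c0, b0), x0) \<in> - {z. D \<in> ?K z}" using False by simp
    ultimately have "\<forall>\<^sub>F z in nhds ((c0, b0), x0). z \<in> - {z. D \<in> ?K z}"
      by (rule eventually_nhds_in_open)
    then show ?thesis by eventually_elim simp
  qed simp
  then have "\<forall>\<^sub>F z in nhds ((c0, b0), x0). \<forall>D. D \<in> ?K z \<longrightarrow> D \<in> KKT_index_sets a c0 b0 x0"
    by (simp add: eventually_all_finite)
  then show ?thesis by (simp add: subset_iff)
qed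

theorem corollary8:
  fixes nrm :: "real ^ 'p \<Rightarrow> real"
    and a :: "'t::finite \<Rightarrow> real ^ 'p"
    and cbar :: "real ^ 'p" and bbar :: "real ^ 't" and xbar :: "real ^ 'p"
  assumes "is_norm nrm"
    and "optimal_set a cbar bbar = {xbar}"
  shows "calmness_modulus (norm_metric (param_norm nrm)) (norm_metric nrm)
           (\<lambda>(c, b). optimal_set a c b) (cbar, bbar) xbar
         = calmness_modulus (norm_metric infnorm) (norm_metric nrm)
           (\<lambda>b. optimal_set a cbar b) bbar xbar
       \<and> calmness_modulus (norm_metric infnorm) (norm_metric nrm)
           (\<lambda>b. optimal_set a cbar b) bbar xbar
         = (SUP D \<in> KKT_index_sets a cbar bbar xbar.
             Limsup (at xbar within {x. f_sup a bbar D x > 0})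
               (\<lambda>x. 1 / mdist_set (norm_metric (dual_norm nrm)) 0
                      (subdifferential (f_sup a bbar D) x)))"
proof -
  note n = assms(1) and unique = assms(2)
  let ?K = "KKT_index_sets a cbar bbar xbar"
  let ?f = "f_sup a bbar"
  define L where "L D = Limsup (at xbar within {x. ?f D x > 0})
    (\<lambda>x. 1 / mdist_set (norm_metric (dual_norm nrm)) 0 (subdifferential (?f D) x))" for D
  define A where "A = calmness_modulus (norm_metric (param_norm nrm)) (norm_metric nrm)
    (\<lambda>(c, b). optimal_set a c b) (cbar, bbar) xbar"
  define B where "B = calmness_modulus (norm_metric infnorm) (norm_metric nrm)
    (\<lambda>b. optimal_set a cbar b) bbar xbar"
  have A: "A = Inf {ereal \<kappa> |\<kappa>. 0 \<le> \<kappa> \<and> (\<forall>\<^sub>F z in nhds ((cbar, bbar), xbar).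
      snd z \<in> optimal_set a (fst (fst z)) (snd (fst z)) \<longrightarrow>
      nrm (snd z - xbar) \<le> \<kappa> * param_norm nrm (fst z - (cbar, bbar)))}"
    unfolding A_def
    by (subst calmness_modulus_singleton[OF is_norm_param_norm[OF n] n])
      (simp_all add: unique case_prod_beta)
  have B: "B = Inf {ereal \<kappa> |\<kappa>. 0 \<le> \<kappa> \<and> (\<forall>\<^sub>F z in nhds (bbar, xbar).
      snd z \<in> optimal_set a cbar (fst z) \<longrightarrow> nrm (snd z - xbar) \<le> \<kappa> * infnorm (fst z - bbar))}"
    unfolding B_def by (rule calmness_modulus_singleton[where S = "\<lambda>b. optimal_set a cbar b", OF is_norm_infnorm n unique])

  \<comment> \<open>On perturbations with \<open>c = cbar\<close>, \<open>param_norm\<close> reduces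
    to \<open>infnorm\<close>, so each calmness constant of the full map serves for the partial
    one.\<close>
  have "B \<le> A"
    unfolding A B
  proof (rule Inf_superset_mono, rule subsetI, clarify)
    fix \<kappa> :: real
    assume "0 \<le> \<kappa>" and ev: "\<forall>\<^sub>F z in nhds ((cbar, bbar), xbar).
      snd z \<in> optimal_set a (fst (fst z)) (snd (fst z)) \<longrightarrow>
      nrm (snd z - xbar) \<le> \<kappa> * param_norm nrm (fst z - (cbar, bbar))"
    have "filterlim (\<lambda>z. ((cbar, fst z), snd z)) (nhds ((cbar, bbar), xbar)) (nhds (bbar, xbar))"
      by (intro tendsto_Pair tendsto_const) (simp_all add: nhds_prod filterlim_fst filterlim_snd)
    from eventually_compose_filterlim[OF ev this] \<open>0 \<le> \<kappa>\<close>
    show "\<exists>\<kappa>'. ereal \<kappa> = ereal \<kappa>' \<and> 0 \<le> \<kappa>' \<and> (\<forall>\<^sub>F z in nhds (bbar, xbar).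
      snd z \<in> optimal_set a cbar (fst z) \<longrightarrow> nrm (snd z - xbar) \<le> \<kappa>' * infnorm (fst z - bbar))"
      by (simp add: param_norm_def is_norm_zero[OF is_norm_dual_norm[OF n]] infnorm_pos_le max_absorb2)
  qed

  \<comment> \<open>Each \<open>x\<close> near \<open>xbar\<close> is optimal for some
    \<open>b\<close> within \<open>?f D x\<close> of \<open>bbar\<close>, so a calmness constant
    becomes an error bound constant for every \<open>D\<close>.\<close>
  moreover have "(SUP D\<in>?K. L D) \<le> B"
    unfolding B
  proof (intro SUP_least Inf_greatest, clarify)
    fix D and \<kappa> :: real
    assume D: "D \<in> ?K" and "0 \<le> \<kappa>" and ev: "\<forall>\<^sub>F z in nhds (bbar, xbar).
      snd z \<in> optimal_set a cbar (fst z) \<longrightarrow> nrm (snd z - xbar) \<le> \<kappa> * infnorm (fst z - bbar)"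
    obtain P Q where PQ: "eventually P (nhds bbar)" "eventually Q (nhds xbar)"
      "\<And>b x. P b \<Longrightarrow> Q x \<Longrightarrow> x \<in> optimal_set a cbar b \<Longrightarrow> nrm (x - xbar) \<le> \<kappa> * infnorm (b - bbar)"
      using ev unfolding nhds_prod eventually_prod_filter by auto
    obtain e where e: "0 < e" "\<And>b. infnorm (b - bbar) < e \<Longrightarrow> P b"
      using PQ(1) unfolding eventually_nhds_is_norm[OF is_norm_infnorm] by blast
    have f0: "0 \<le> ?f D x" for x
      using f_sup_xbar[OF unique D] f_sup_pos[OF unique D, of x] by (cases "x = xbar") auto
    have "isCont (?f D) xbar"
      using convex_on_continuous[OF open_UNIV convex_on_f_sup[of a bbar D]] by (simp add: continuous_on_eq_continuous_at)
    then have "(?f D \<longlongrightarrow> ?f D xbar) (nhds xbar)"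
      unfolding isCont_def tendsto_at_iff_tendsto_nhds .
    \<comment> \<open>Keeps the perturbed right-hand side in the neighborhood where the calmness
      estimate is valid.\<close>
    then have "\<forall>\<^sub>F x in nhds xbar. ?f D x < e"
      by (rule order_tendstoD(2)) (simp add: f_sup_xbar[OF unique D] e(1))
    then have "\<forall>\<^sub>F x in nhds xbar. nrm (x - xbar) \<le> \<kappa> * ?f D x"
      using PQ(2)
    proof eventually_elim
      case (elim x)
      obtain b where b: "x \<in> optimal_set a cbar b" "infnorm (b - bbar) \<le> ?f D x"
        using exists_perturbation_optimal[OF _ f0, of cbar] D by (auto simp: KKT_index_sets_def)
      then have "nrm (x - xbar) \<le> \<kappa> * infnorm (b - bbar)" using elim PQ(3) e(2) by auto
      also have "\<dots> \<le> \<kappa> * ?f D x" using b(2) \<open>0 \<le> \<kappa>\<close> by (rule mult_left_mono)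
      finally show ?case .
    qed
    then show "L D \<le> ereal \<kappa>"
      unfolding L_def by (rule Limsup_of_error_bound[where f = "?f D", OF n f_sup_xbar[OF unique D]])
  qed

  moreover have "A \<le> (SUP D\<in>?K. L D)"
  \<comment> \<open>Passing to \<open>q\<close> strictly above the supremum supplies the strict
    bound on \<open>L D\<close> from which an error bound follows.\<close>
  proof (rule dense_ge)
    fix q :: ereal
    assume q: "(SUP D\<in>?K. L D) < q"
    have "0 < q"
    proof -
      obtain D where D: "D \<in> ?K" using KKT_index_set_of_optimal[where x = xbar and a = a and c = cbar and b = bbar] unique by auto
      \<comment> \<open>This makes the filter nontrivial, so the upper limit of nonnegative
        quotients is nonnegative. Since \<open>?K\<close> is nonempty, \<open>q\<close> is then
        positive.\<close>
      have "at xbar within {x. ?f D x > 0} = at xbar"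
        using f_sup_pos[OF unique D] by (intro at_within_nhd[of _ UNIV]) auto
      then have "0 \<le> L D"
        unfolding L_def mdist_set_def
        by (intro le_Limsup always_eventually allI) (auto intro!: inverse_ereal_ge0I INF_greatest simp: divide_ereal_def)
      also have "\<dots> \<le> (SUP D\<in>?K. L D)" using D by (rule SUP_upper)
      finally show ?thesis using q by simp
    qed
    show "A \<le> q"
    proof (cases q)
      case (real \<kappa>)
      then have "0 < \<kappa>" using \<open>0 < q\<close> by simp
      have bound: "\<forall>\<^sub>F x in nhds xbar. D \<in> ?K \<longrightarrow> nrm (x - xbar) \<le> \<kappa> * ?f D x" for D
      proof (cases "D \<in> ?K")
        case True
        have "L D < ereal \<kappa>" using q real True by (metis SUP_upper le_less_trans)
        then show ?thesis
          using error_bound_of_Limsup[OF n convex_on_f_sup f_sup_xbar[OF unique True]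
              f_sup_pos[OF unique True] _ \<open>0 < \<kappa>\<close>] True
          by (auto simp: L_def)
      qed simp
      \<comment> \<open>Finitely many index sets allow one neighborhood for all the error
        bounds.\<close>
      have "\<forall>\<^sub>F x in nhds xbar. \<forall>D. D \<in> ?K \<longrightarrow> nrm (x - xbar) \<le> \<kappa> * ?f D x"
        using bound by (rule eventually_all_finite)
      moreover have "filterlim snd (nhds xbar) (nhds ((cbar, bbar), xbar))"
        by (simp add: nhds_prod filterlim_snd)
      ultimately have "\<forall>\<^sub>F z in nhds ((cbar, bbar), xbar).
          \<forall>D. D \<in> ?K \<longrightarrow> nrm (snd z - xbar) \<le> \<kappa> * ?f D (snd z)"
        by (rule eventually_compose_filterlim)
      then have "\<forall>\<^sub>F z in nhds ((cbar, bbar), xbar).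
          snd z \<in> optimal_set a (fst (fst z)) (snd (fst z)) \<longrightarrow>
          nrm (snd z - xbar) \<le> \<kappa> * param_norm nrm (fst z - (cbar, bbar))"
        using eventually_KKT_index_sets[where a = a and ?c0.0 = cbar and ?b0.0 = bbar and ?x0.0 = xbar]
      proof eventually_elim
        case (elim z)
        obtain c b x where z: "z = ((c, b), x)" by (metis prod.exhaust)
        have "nrm (x - xbar) \<le> \<kappa> * param_norm nrm (c - cbar, b - bbar)" if x: "x \<in> optimal_set a c b"
        proof -
          \<comment> \<open>\<open>D\<close> belongs to the perturbed problem, but close to the
            reference point it also lies in \<open>?K\<close>, where the error bound is
            available.\<close>
          obtain D where D: "D \<in> KKT_index_sets a c b x" using KKT_index_set_of_optimal[OF x] .
          then have "nrm (x - xbar) \<le> \<kappa> * ?f D x" using elim by (auto simp: z)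
          also have "?f D x \<le> infnorm (b - bbar)"
            using x D by (intro f_sup_le_infnorm) (auto simp: optimal_set_iff KKT_index_sets_def)
          also have "\<dots> \<le> param_norm nrm (c - cbar, b - bbar)" by (simp add: param_norm_def)
          finally show ?thesis using \<open>0 < \<kappa>\<close> by simp
        qed
        then show ?case by (simp add: z)
      qed
      then show ?thesis
        unfolding A real using \<open>0 < \<kappa>\<close> by (intro Inf_lower CollectI exI[of _ \<kappa>]) auto
    qed (use \<open>0 < q\<close> in auto)
  qed
  ultimately show ?thesis unfolding A_def B_def L_def by auto
qed

end
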